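(* Let $I\subset\mathbb R\setminus\{0\}$ be an open interval, $f:I\to\mathbb R$ smooth with $f'^2<1$ and $f'\neq0$ everywhere on $I$, and let $C_4\neq0$ be a real constant. Let $M$ be the rotational hypersurface $\Gamma^s(s,t,w)=(s\cosh t\cosh w,\ s\sinh t,\ s\cosh t\sinh w,\ f(s))$ in $\mathbb E_1^4$ with Gauss map $N^{s}=-\frac{1}{\sqrt{1-f'^2}}(f'\cosh t\cosh w,\ f'\sinh t,\ f'\cosh t\sinh w,\ 1)$, and assume $L_1N^s$ is not identically zero. If the differential equation $$0=\left(C_4\sqrt{1-f'^2}-1\right)\Big(2(f'^2-1)^3f'^2-2s(f'^2-1)f'^3f''+2s^2(4f'^2+1)f''^2-2s^2(f'^2-1)f'f'''\Big)-2s\Big(s(f'^2-1)f'f'''+\big((f'^2-1)f'-s(3f'^2+2)f''\big)f''\Big)f'^2$$ holds on $I$, then $M$ has second kind $L_1$-pointwise 1-type Gauss map; namely $L_1N^s=\mathfrak m(N^s+C)$ for some non-zero smooth function $\mathfrak m$, with $C=(0,0,0,C_4)$.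
   Context: $\mathbb E_1^4$ is $\mathbb R^4$ with the Lorentzian metric $\langle\,,\rangle=-dx_1^2+dx_2^2+dx_3^2+dx_4^2$. Let $M$ be an oriented hypersurface of $\mathbb E_1^4$ with nondegenerate induced metric $g$, unit normal vector field (Gauss map) $N$, $\varepsilon=\langle N,N\rangle=\pm1$, shape operator $S=-dN$ and principal curvatures $\kappa_1,\kappa_2,\kappa_3$. Put $a_0=1$, $a_1=-(\kappa_1+\kappa_2+\kappa_3)$, $a_2=\kappa_1\kappa_2+\kappa_1\kappa_3+\kappa_2\kappa_3$, $a_3=-\kappa_1\kappa_2\kappa_3$. The Newton transformations are $P_0=I$, $P_k=a_kI+S\circ P_{k-1}$, and $L_k(\varphi)=\mathrm{tr}(P_k\circ\nabla^2\varphi)$ for $\varphi\in C^\infty(M)$, where $\nabla^2\varphi$ is the Hessian operator of $\varphi$ with respect to $g$; $L_k$ acts componentwise on $\mathbb R^4$-valued functions such as $N$. With $n=3$, $\binom{n}{k}H_k=(-\varepsilon)^ka_k$ and $C_k=\binom{n}{k+1}(-\varepsilon)^k$, the known formula used for the Gauss map is $L_kN=-\varepsilon C_k\big(\nabla H_{k+1}+(nH_1H_{k+1}-(n-k-1)H_{k+2})N\big)$, where $\nabla$ is the gradient of $g$. $M$ has second kind $L_k$-pointwise 1-type Gauss map if $L_kN=\mathfrak m(N+C)$ for a non-zero (i.e. not identically zero) smooth function $\mathfrak m$ on $M$ and a non-zero constant vector $C\in\mathbb E_1^4$. Primes denote $d/ds$; $s\in I$ and $t,w\in\mathbb R$. 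*)

theory Defs
  imports "HOL-Analysis.Analysis"
begin

text \<open>Used on open sets only, where \<open>frechet_derivative\<close> is the two-sided derivative.\<close>

fun Ck_on :: "nat \<Rightarrow> ('a::euclidean_space \<Rightarrow> 'b::real_normed_vector) \<Rightarrow> 'a set \<Rightarrow> bool" where
  "Ck_on 0 \<phi> U \<longleftrightarrow> continuous_on U \<phi>"
| "Ck_on (Suc k) \<phi> U \<longleftrightarrow>
     \<phi> differentiable_on U \<and> (\<forall>b\<in>Basis. Ck_on k (\<lambda>x. frechet_derivative \<phi> (at x) b) U)"

definition smooth_on :: "('a::euclidean_space \<Rightarrow> 'b::real_normed_vector) \<Rightarrow> 'a set \<Rightarrow> bool" where
  "smooth_on \<phi> U \<longleftrightarrow> (\<forall>k. Ck_on k \<phi> U)"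

definition lorentz :: "real^4 \<Rightarrow> real^4 \<Rightarrow> real" where
  "lorentz x y = - (x$1 * y$1) + x$2 * y$2 + x$3 * y$3 + x$4 * y$4"

text \<open>A hypersurface is given by a parametrization \<open>X\<close> of an open set \<open>U\<close> of parameters.
  Functions on the hypersurface are functions of the parameter, and tangent vectors and
  operators on tangent spaces are given by their components in the coordinate frame
  \<open>\<partial>\<^sub>1 X, \<partial>\<^sub>2 X, \<partial>\<^sub>3 X\<close>; column \<open>j\<close> of an operator, i.e. the entries \<open>A $ i $ j\<close>, is the image
  of \<open>\<partial>\<^sub>j X\<close>.\<close>

definition partial :: "3 \<Rightarrow> (real^3 \<Rightarrow> 'b::real_normed_vector) \<Rightarrow> real^3 \<Rightarrow> 'b" where
  "partial i \<phi> p = frechet_derivative \<phi> (at p) (axis i 1)"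

definition metric :: "(real^3 \<Rightarrow> real^4) \<Rightarrow> real^3 \<Rightarrow> real^3^3" where
  "metric X p = (\<chi> i j. lorentz (partial i X p) (partial j X p))"

text \<open>A nondegenerate metric forces \<open>X\<close> to be an immersion.\<close>

definition oriented_hypersurface ::
  "(real^3) set \<Rightarrow> (real^3 \<Rightarrow> real^4) \<Rightarrow> (real^3 \<Rightarrow> real^4) \<Rightarrow> bool" where
  "oriented_hypersurface U X N \<longleftrightarrow>
     open U \<and> smooth_on X U \<and> smooth_on N U \<and>
     (\<forall>p\<in>U. det (metric X p) \<noteq> 0) \<and>
     (\<forall>p\<in>U. \<forall>i. lorentz (N p) (partial i X p) = 0) \<and>
     (\<exists>\<epsilon>\<in>{-1, 1}. \<forall>p\<in>U. lorentz (N p) (N p) = \<epsilon>)"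

definition shape_operator :: "(real^3 \<Rightarrow> real^4) \<Rightarrow> (real^3 \<Rightarrow> real^4) \<Rightarrow> real^3 \<Rightarrow> real^3^3" where
  "shape_operator X N p =
     (THE S. \<forall>j. - partial j N p = (\<Sum>i\<in>UNIV. (S$i$j) *\<^sub>R partial i X p))"

text \<open>The eigenvalues of the shape operator, counted with algebraic multiplicity. As the
  metric may be indefinite, these need not be real. The choice fixes only their order, and
  only symmetric functions of them are used.\<close>

definition principal_curvatures :: "real^3^3 \<Rightarrow> 3 \<Rightarrow> complex" where
  "principal_curvatures S =
     (SOME \<kappa>. \<forall>z. det (mat z - map_matrix complex_of_real S) = (\<Prod>i\<in>UNIV. z - \<kappa> i))"

text \<open>\<open>(-1)\<^sup>k\<close> times the \<open>k\<close>-th elementary symmetric function of the principal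
  curvatures; this is real because non-real eigenvalues come in conjugate pairs.\<close>

definition curv_coeff :: "real^3^3 \<Rightarrow> nat \<Rightarrow> real" where
  "curv_coeff S k =
     (-1) ^ k * Re (\<Sum>A | card A = k. \<Prod>i\<in>A. principal_curvatures S i)"

primrec newton_transformation :: "real^3^3 \<Rightarrow> nat \<Rightarrow> real^3^3" where
  "newton_transformation S 0 = mat 1"
| "newton_transformation S (Suc k) = mat (curv_coeff S (Suc k)) + S ** newton_transformation S k"

definition gradient :: "(real^3 \<Rightarrow> real^4) \<Rightarrow> (real^3 \<Rightarrow> real) \<Rightarrow> real^3 \<Rightarrow> real^3" where
  "gradient X \<phi> p = (\<chi> i. \<Sum>l\<in>UNIV. matrix_inv (metric X p) $ i $ l * partial l \<phi> p)"

text \<open>Christoffel symbols \<open>\<Gamma>\<^sup>i\<^bsub>jk\<^esub>\<close> of the Levi-Civita connection.\<close>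

definition christoffel :: "(real^3 \<Rightarrow> real^4) \<Rightarrow> real^3 \<Rightarrow> 3 \<Rightarrow> 3 \<Rightarrow> 3 \<Rightarrow> real" where
  "christoffel X p i j k =
     1/2 * (\<Sum>l\<in>UNIV. matrix_inv (metric X p) $ i $ l *
       (partial j (\<lambda>q. metric X q $ k $ l) p
        + partial k (\<lambda>q. metric X q $ j $ l) p
        - partial l (\<lambda>q. metric X q $ j $ k) p))"

text \<open>Column \<open>j\<close> is the covariant derivative of the gradient in direction \<open>\<partial>\<^sub>j X\<close>.\<close>

definition hessian_operator :: "(real^3 \<Rightarrow> real^4) \<Rightarrow> (real^3 \<Rightarrow> real) \<Rightarrow> real^3 \<Rightarrow> real^3^3" where
  "hessian_operator X \<phi> p =
     (\<chi> i j. partial j (\<lambda>q. gradient X \<phi> q $ i) p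
            + (\<Sum>k\<in>UNIV. christoffel X p i j k * gradient X \<phi> p $ k))"

definition L_operator ::
  "nat \<Rightarrow> (real^3 \<Rightarrow> real^4) \<Rightarrow> (real^3 \<Rightarrow> real^4) \<Rightarrow> (real^3 \<Rightarrow> real) \<Rightarrow> real^3 \<Rightarrow> real" where
  "L_operator k X N \<phi> p =
     trace (newton_transformation (shape_operator X N p) k ** hessian_operator X \<phi> p)"

definition L_Gauss_map ::
  "nat \<Rightarrow> (real^3 \<Rightarrow> real^4) \<Rightarrow> (real^3 \<Rightarrow> real^4) \<Rightarrow> real^3 \<Rightarrow> real^4" where
  "L_Gauss_map k X N p = (\<chi> a. L_operator k X N (\<lambda>q. N q $ a) p)"

definition second_kind_pointwise_1_type ::
  "nat \<Rightarrow> (real^3) set \<Rightarrow> (real^3 \<Rightarrow> real^4) \<Rightarrow> (real^3 \<Rightarrow> real^4) \<Rightarrow> bool" where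
  "second_kind_pointwise_1_type k U X N \<longleftrightarrow>
     oriented_hypersurface U X N \<and>
     (\<exists>m C. smooth_on m U \<and> (\<exists>p\<in>U. m p \<noteq> 0) \<and> C \<noteq> 0 \<and>
        (\<forall>p\<in>U. L_Gauss_map k X N p = m p *\<^sub>R (N p + C)))"

text \<open>The parameter is \<open>p = (s, t, w)\<close>.\<close>

definition rot_domain :: "real set \<Rightarrow> (real^3) set" where
  "rot_domain I = {p. p$1 \<in> I}"

definition rot_hypersurface :: "(real \<Rightarrow> real) \<Rightarrow> real^3 \<Rightarrow> real^4" where
  "rot_hypersurface f p =
     vector [p$1 * cosh (p$2) * cosh (p$3), p$1 * sinh (p$2), p$1 * cosh (p$2) * sinh (p$3), f (p$1)]"

definition rot_Gauss_map :: "(real \<Rightarrow> real) \<Rightarrow> real^3 \<Rightarrow> real^4" where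
  "rot_Gauss_map f p =
     - (1 / sqrt (1 - (deriv f (p$1))\<^sup>2)) *\<^sub>R
       vector [deriv f (p$1) * cosh (p$2) * cosh (p$3), deriv f (p$1) * sinh (p$2),
               deriv f (p$1) * cosh (p$2) * sinh (p$3), 1]"

end

theory Submission
  imports Defs
begin

text \<open>Put \<open>W = sqrt (1 - f'\<^sup>2)\<close>. In the coordinates \<open>(s, t, w)\<close> the metric is diagonal with entries \<open>-W\<^sup>2\<close>,
  \<open>s\<^sup>2\<close>, \<open>s\<^sup>2 (cosh t)\<^sup>2\<close>, and the coordinate directions are principal, with curvatures \<open>f'' / W\<^sup>3\<close> and
  (twice) \<open>f' / (s W)\<close>. The first three components of the Gauss map are \<open>- f' / W\<close> times the components of
  the position vector \<open>E\<close> of the hyperbolic plane, which are eigenfunctions of its Laplacian with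
  eigenvalue \<open>2\<close>; the fourth component is \<open>- 1 / W\<close>. Consequently \<open>L\<^sub>1 N = (a E, b)\<close> with
  \<open>a = - Q / (s\<^sup>3 W\<^sup>8)\<close> and \<open>b = 2 f' R / (s\<^sup>2 W\<^sup>8)\<close>, where \<open>Q\<close> and \<open>R\<close> are the two brackets of the differential
  equation. The first three components force \<open>m = Q / (f' s\<^sup>3 W\<^sup>7)\<close>, and then the differential equation
  \<open>(C\<^sub>4 W - 1) Q = 2 s R f'\<^sup>2\<close> is the equality of the fourth components.\<close>

section \<open>Smooth functions on open sets\<close>

text \<open>On an open set a derivative at a point depends only on nearby values, so agreement on
  \<open>U\<close> passes to the derivatives and the induction continues with them.\<close>

lemma Ck_on_cong:
  assumes "open U" "\<And>x. x \<in> U \<Longrightarrow> \<phi> x = \<psi> x" "Ck_on k \<phi> U"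
  shows "Ck_on k \<psi> U"
  using assms(2,3)
proof (induction k arbitrary: \<phi> \<psi>)
  case 0
  then show ?case by (metis Ck_on.simps(1) continuous_on_cong)
next
  case (Suc k)
  have "frechet_derivative \<phi> (at x) = frechet_derivative \<psi> (at x)" if "x \<in> U" for x
    using frechet_derivative_transform_within_open[OF _ assms(1) that] Suc.prems that
    by (metis Ck_on.simps(2) assms(1) differentiable_on_eq_differentiable_at)
  moreover have "\<psi> differentiable_on U"
    using Suc.prems unfolding differentiable_on_def
    by (metis (no_types, lifting) Ck_on.simps(2) differentiable_on_def differentiable_transform_within zero_less_one)
  ultimately show ?case
    using Suc.IH[of "\<lambda>x. frechet_derivative \<phi> (at x) b" "\<lambda>x. frechet_derivative \<psi> (at x) b" for b]
      Suc.prems by simp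
qed

text \<open>By uniqueness of derivatives, any explicit formula \<open>D\<close> may stand in for the
  \<open>frechet_derivative\<close> of the definition; every induction on \<open>k\<close> below
  enters through this rule.\<close>

lemma Ck_on_SucI:
  assumes "open U" "\<And>x. x \<in> U \<Longrightarrow> (\<phi> has_derivative D x) (at x)"
    "\<And>b. b \<in> Basis \<Longrightarrow> Ck_on k (\<lambda>x. D x b) U"
  shows "Ck_on (Suc k) \<phi> U"
proof -
  have "D x = frechet_derivative \<phi> (at x)" if "x \<in> U" for x
    using assms(2)[OF that] by (rule frechet_derivative_at)
  then have "Ck_on k (\<lambda>x. frechet_derivative \<phi> (at x) b) U" if "b \<in> Basis" for b
    using Ck_on_cong[OF assms(1) _ assms(3)[OF that]] by simp
  moreover have "\<phi> differentiable_on U"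
    using assms(2) by (auto simp: differentiable_on_def differentiable_def intro: has_derivative_at_withinI)
  ultimately show ?thesis by simp
qed

lemma Ck_on_SucD:
  assumes "open U" "Ck_on (Suc k) \<phi> U"
  shows "x \<in> U \<Longrightarrow> (\<phi> has_derivative frechet_derivative \<phi> (at x)) (at x)"
    "b \<in> Basis \<Longrightarrow> Ck_on k (\<lambda>x. frechet_derivative \<phi> (at x) b) U"
  using assms by (auto simp: differentiable_on_eq_differentiable_at frechet_derivative_works)

lemma Ck_on_Suc_imp: "Ck_on (Suc k) \<phi> U \<Longrightarrow> Ck_on k \<phi> U"
proof (induction k arbitrary: \<phi>)
  case 0
  then show ?case by (simp add: differentiable_imp_continuous_on)
next
  case (Suc k)
  then show ?case by (metis Ck_on.simps(2))
qed

lemma Ck_on_const: "open U \<Longrightarrow> Ck_on k (\<lambda>x. c) U"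
proof (induction k arbitrary: c)
  case (Suc k)
  show ?case
    by (rule Ck_on_SucI[where D = "\<lambda>x v. 0"]) (use Suc in auto)
qed simp

lemma Ck_on_bounded_linear:
  assumes "open U" "bounded_linear L"
  shows "Ck_on k L U"
proof (cases k)
  case 0
  then show ?thesis using assms by (simp add: bounded_linear.continuous_on[OF _ continuous_on_id])
next
  case (Suc n)
  show ?thesis unfolding Suc
    by (rule Ck_on_SucI[where D = "\<lambda>x. L"])
      (use assms in \<open>auto intro: Ck_on_const bounded_linear_imp_has_derivative\<close>)
qed

lemma Ck_on_add:
  assumes "open U" "Ck_on k \<phi> U" "Ck_on k \<psi> U"
  shows "Ck_on k (\<lambda>x. \<phi> x + \<psi> x) U"
  using assms(2,3)
proof (induction k arbitrary: \<phi> \<psi>)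
  case 0
  then show ?case by (simp add: continuous_on_add)
next
  case (Suc k)
  show ?case
    by (rule Ck_on_SucI[OF assms(1) has_derivative_add])
      (use Suc Ck_on_SucD[OF assms(1)] in blast)+
qed

text \<open>Leibniz rule: each summand of the derivative pairs a derivative of class k with an
  undifferentiated factor, which is lowered from class k + 1 by \<open>Ck_on_Suc_imp\<close>. The
  bilinear form covers real and scalar products at once.\<close>

lemma (in bounded_bilinear) Ck_on_prod:
  assumes "open U" "Ck_on k \<phi> U" "Ck_on k \<psi> U"
  shows "Ck_on k (\<lambda>x. prod (\<phi> x) (\<psi> x)) U"
  using assms(2,3)
proof (induction k arbitrary: \<phi> \<psi>)
  case 0
  then show ?case by (simp add: continuous_on)
next
  case (Suc k)
  note D = Ck_on_SucD[OF assms(1) Suc.prems(1)] Ck_on_SucD[OF assms(1) Suc.prems(2)]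
  show ?case
    by (rule Ck_on_SucI[OF assms(1) FDERIV[OF D(1) D(3)]])
      (simp_all add: D Ck_on_add[OF assms(1)] Suc.IH Suc.prems[THEN Ck_on_Suc_imp])
qed

text \<open>In the chain rule the inner function stays and the outer one becomes its derivative, so
  the induction varies \<open>g\<close> alone.\<close>

lemma Ck_on_compose:
  fixes \<phi> :: "'a::euclidean_space \<Rightarrow> real" and g :: "real \<Rightarrow> real"
  assumes "open U" "open V" "Ck_on k \<phi> U" "Ck_on k g V" "\<phi> ` U \<subseteq> V"
  shows "Ck_on k (\<lambda>x. g (\<phi> x)) U"
  using assms(3,4)
proof (induction k arbitrary: g)
  case 0
  then show ?case using assms(5) by (auto intro: continuous_on_compose2)
next
  case (Suc k)
  define g' where "g' = (\<lambda>y. frechet_derivative g (at y) 1)"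
  have "(g has_real_derivative g' y) (at y)" if "y \<in> V" for y
  proof -
    have "(g has_derivative frechet_derivative g (at y)) (at y)"
      using Ck_on_SucD[OF assms(2) Suc.prems(2)] that by blast
    \<comment> \<open>A linear map on the reals is multiplication by its value at 1, which is
      \<open>g' y\<close>.\<close>
    moreover from this have "frechet_derivative g (at y) v = g' y * v" for v
      using linear_scale[OF bounded_linear.linear[OF has_derivative_bounded_linear], of g _ "at y" v 1]
      by (simp add: g'_def mult.commute)
    ultimately show ?thesis
      by (metis has_derivative_imp_has_field_derivative mult.commute)
  qed
  then have "((\<lambda>x. g (\<phi> x)) has_derivative (\<lambda>v. g' (\<phi> x) * frechet_derivative \<phi> (at x) v)) (at x)"
    if "x \<in> U" for x
    using DERIV_compose_FDERIV[of g "g' (\<phi> x)" \<phi> x, OF _ Ck_on_SucD(1)[OF assms(1) Suc.prems(1) that]]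
      that assms(5) by (auto simp: mult.commute)
  moreover have "Ck_on k g' V"
    using Ck_on_SucD(2)[OF assms(2) Suc.prems(2), of 1] by (simp add: g'_def)
  then have "Ck_on k (\<lambda>x. g' (\<phi> x)) U"
    using Suc Ck_on_Suc_imp by blast
  then have "Ck_on k (\<lambda>x. g' (\<phi> x) * frechet_derivative \<phi> (at x) b) U" if "b \<in> Basis" for b
    using bounded_bilinear.Ck_on_prod[OF bounded_bilinear_mult assms(1)]
      Ck_on_SucD(2)[OF assms(1) Suc.prems(1) that] by blast
  ultimately show ?case
    by (rule Ck_on_SucI[OF assms(1)])
qed

lemma Ck_on_real_SucI:
  fixes g g' :: "real \<Rightarrow> real"
  assumes "open V" "\<And>y. y \<in> V \<Longrightarrow> (g has_real_derivative g' y) (at y)" "Ck_on k g' V"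
  shows "Ck_on (Suc k) g V"
  using assms by (intro Ck_on_SucI[of V g "\<lambda>x. (*) (g' x)"]) (auto simp: has_field_derivative_def)

section \<open>Closure properties of smooth functions\<close>

lemma smooth_on_const [intro]: "open U \<Longrightarrow> smooth_on (\<lambda>x. c) U"
  and smooth_on_add [intro]: "open U \<Longrightarrow> smooth_on \<phi> U \<Longrightarrow> smooth_on \<psi> U \<Longrightarrow> smooth_on (\<lambda>x. \<phi> x + \<psi> x) U"
  by (simp_all add: smooth_on_def Ck_on_const Ck_on_add)

lemma smooth_on_bounded_linear: "open U \<Longrightarrow> bounded_linear L \<Longrightarrow> smooth_on L U"
  by (simp add: smooth_on_def Ck_on_bounded_linear)

lemma smooth_on_mult [intro]:
  fixes \<phi> \<psi> :: "'a::euclidean_space \<Rightarrow> real"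
  shows "open U \<Longrightarrow> smooth_on \<phi> U \<Longrightarrow> smooth_on \<psi> U \<Longrightarrow> smooth_on (\<lambda>x. \<phi> x * \<psi> x) U"
  by (simp add: smooth_on_def bounded_bilinear.Ck_on_prod[OF bounded_bilinear_mult])

lemma smooth_on_scaleR [intro]:
  "open U \<Longrightarrow> smooth_on \<phi> U \<Longrightarrow> smooth_on \<psi> U \<Longrightarrow> smooth_on (\<lambda>x. \<phi> x *\<^sub>R \<psi> x) U"
  by (simp add: smooth_on_def bounded_bilinear.Ck_on_prod[OF bounded_bilinear_scaleR])

lemma smooth_on_diff [intro]:
  fixes \<phi> \<psi> :: "'a::euclidean_space \<Rightarrow> real"
  shows "open U \<Longrightarrow> smooth_on \<phi> U \<Longrightarrow> smooth_on \<psi> U \<Longrightarrow> smooth_on (\<lambda>x. \<phi> x - \<psi> x) U"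
  using smooth_on_add[of U \<phi> "\<lambda>x. -1 * \<psi> x"] smooth_on_mult[of U "\<lambda>x. -1" \<psi>]
    smooth_on_const[of U "-1 :: real"] by simp

lemma smooth_on_power [intro]:
  fixes \<phi> :: "'a::euclidean_space \<Rightarrow> real"
  shows "open U \<Longrightarrow> smooth_on \<phi> U \<Longrightarrow> smooth_on (\<lambda>x. \<phi> x ^ n) U"
  by (induction n) (simp_all add: smooth_on_const smooth_on_mult)

lemma smooth_on_compose:
  fixes \<phi> :: "'a::euclidean_space \<Rightarrow> real" and g :: "real \<Rightarrow> real"
  shows "open U \<Longrightarrow> open V \<Longrightarrow> smooth_on \<phi> U \<Longrightarrow> smooth_on g V \<Longrightarrow> \<phi> ` U \<subseteq> V \<Longrightarrow> smooth_on (\<lambda>x. g (\<phi> x)) U"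
  by (simp add: smooth_on_def Ck_on_compose)

section \<open>Smoothness of elementary functions\<close>

lemma smooth_on_cosh_sinh: "smooth_on cosh (UNIV :: real set)" "smooth_on sinh (UNIV :: real set)"
proof -
  have "Ck_on k cosh (UNIV :: real set) \<and> Ck_on k sinh (UNIV :: real set)" for k
  proof (induction k)
    case 0
    show ?case by (auto intro!: continuous_intros)
  next
    case (Suc k)
    moreover have "(cosh has_real_derivative sinh y) (at y)" "(sinh has_real_derivative cosh y) (at y)" for y :: real
      by (auto intro!: derivative_eq_intros)
    ultimately show ?case
      by (blast intro: Ck_on_real_SucI)
  qed
  then show "smooth_on cosh (UNIV :: real set)" "smooth_on sinh (UNIV :: real set)"
    by (simp_all add: smooth_on_def)
qed

text \<open>Differentiation lowers the exponent by one, so the induction runs over all exponents;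
  the exponent 1/2 later gives the square root.\<close>

lemma smooth_on_powr: "smooth_on (\<lambda>x::real. x powr a) {0<..}"
proof -
  have "Ck_on k (\<lambda>x::real. x powr a) {0<..}" for k
  proof (induction k arbitrary: a)
    case 0
    show ?case by (auto intro!: continuous_intros)
  next
    case (Suc k)
    show ?case
      by (rule Ck_on_real_SucI[where g' = "\<lambda>x. a * x powr (a - 1)"])
        (auto intro!: derivative_eq_intros Suc Ck_on_const
          bounded_bilinear.Ck_on_prod[OF bounded_bilinear_mult])
  qed
  then show ?thesis by (simp add: smooth_on_def)
qed

text \<open>The derivative is minus the square of the function itself, so the product rule closes
  the induction.\<close>

lemma smooth_on_inverse_nonzero: "smooth_on (inverse :: real \<Rightarrow> real) (- {0})"
proof -
  have "Ck_on k (inverse :: real \<Rightarrow> real) (- {0})" for k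
  proof (induction k)
    case 0
    show ?case by (simp add: continuous_on_inverse)
  next
    case (Suc k)
    have "Ck_on k (\<lambda>x::real. (-1) * (inverse x * inverse x)) (- {0})"
      by (intro bounded_bilinear.Ck_on_prod[OF bounded_bilinear_mult] Ck_on_const Suc) auto
    then show ?case
      by (rule Ck_on_real_SucI[rotated 2]) (auto intro!: derivative_eq_intros)
  qed
  then show ?thesis by (simp add: smooth_on_def)
qed

lemma smooth_on_divide [intro]:
  fixes \<phi> \<psi> :: "'a::euclidean_space \<Rightarrow> real"
  assumes "open U" "smooth_on \<phi> U" "smooth_on \<psi> U" "\<And>x. x \<in> U \<Longrightarrow> \<psi> x \<noteq> 0"
  shows "smooth_on (\<lambda>x. \<phi> x / \<psi> x) U"
  unfolding divide_inverse using assms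
  by (intro smooth_on_mult smooth_on_compose[OF _ _ _ smooth_on_inverse_nonzero]) auto

lemma smooth_on_cong:
  assumes "open U" "smooth_on \<psi> U" "\<And>x. x \<in> U \<Longrightarrow> \<phi> x = \<psi> x"
  shows "smooth_on \<phi> U"
  using assms by (metis Ck_on_cong smooth_on_def)

lemma smooth_on_sqrt [intro]:
  fixes \<phi> :: "'a::euclidean_space \<Rightarrow> real"
  assumes "open U" "smooth_on \<phi> U" "\<And>x. x \<in> U \<Longrightarrow> \<phi> x > 0"
  shows "smooth_on (\<lambda>x. sqrt (\<phi> x)) U"
  by (rule smooth_on_cong[where \<psi> = "\<lambda>x. \<phi> x powr (1/2)"])
    (use assms in \<open>auto simp: powr_half_sqrt order.strict_implies_order
      intro!: smooth_on_compose[OF _ _ _ smooth_on_powr]\<close>)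

lemma smooth_on_vec:
  fixes \<phi> :: "'a::euclidean_space \<Rightarrow> real ^ 'n"
  assumes "open U" "\<And>i. smooth_on (\<lambda>x. \<phi> x $ i) U"
  shows "smooth_on \<phi> U"
proof -
  have smooth: "smooth_on (\<lambda>x. \<Sum>i\<in>A. \<phi> x $ i *\<^sub>R axis i (1::real)) U" if "finite A" for A
    using that
    by induction (simp_all add: assms smooth_on_const smooth_on_add smooth_on_scaleR)
  have sum: "(\<Sum>i\<in>UNIV. \<phi> x $ i *\<^sub>R axis i 1) = \<phi> x" for x
    using basis_expansion[of "\<phi> x"] by (simp add: scalar_mult_eq_scaleR)
  from smooth[OF finite[of UNIV], unfolded sum] show ?thesis .
qed

lemma smooth_on_imp_differentiable:
  "open U \<Longrightarrow> smooth_on \<phi> U \<Longrightarrow> x \<in> U \<Longrightarrow> \<phi> differentiable (at x)"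
  by (metis Ck_on_SucD(1) differentiableI smooth_on_def)

text \<open>Links the \<open>deriv\<close> of the profile function with the Frechet derivatives in
  \<open>smooth_on\<close>; iterated, it supplies all higher derivatives of the profile.\<close>

lemma smooth_on_deriv:
  fixes g :: "real \<Rightarrow> real"
  assumes "open V" "smooth_on g V"
  shows "smooth_on (deriv g) V" "y \<in> V \<Longrightarrow> (g has_real_derivative deriv g y) (at y)"
proof -
  show D: "(g has_real_derivative deriv g y) (at y)" if "y \<in> V" for y
    using smooth_on_imp_differentiable[OF assms that]
    by (metis DERIV_imp_deriv real_differentiableE)
  have "deriv g y = frechet_derivative g (at y) 1" if "y \<in> V" for y
    using frechet_derivative_at[OF D[OF that, unfolded has_field_derivative_def]] by (metis mult.right_neutral)
  moreover have "smooth_on (\<lambda>y. frechet_derivative g (at y) 1) V"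
    unfolding smooth_on_def
  proof
    fix k
    have "Ck_on (Suc k) g V" using assms(2) unfolding smooth_on_def by blast
    from Ck_on_SucD(2)[OF assms(1) this] show "Ck_on k (\<lambda>y. frechet_derivative g (at y) 1) V" by simp
  qed
  ultimately show "smooth_on (deriv g) V"
    using smooth_on_cong[OF assms(1)] by blast
qed

section \<open>Hypersurfaces with an orthogonal coordinate frame\<close>

lemma vector_4 [simp]:
  fixes x y z w :: "'a::zero"
  shows "(vector [x, y, z, w] :: 'a^4) $ 1 = x" "(vector [x, y, z, w] :: 'a^4) $ 2 = y"
    "(vector [x, y, z, w] :: 'a^4) $ 3 = z" "(vector [x, y, z, w] :: 'a^4) $ 4 = w"
  unfolding vector_def by simp_all

lemma partial_eq: "(\<phi> has_derivative D) (at p) \<Longrightarrow> partial i \<phi> p = D (axis i 1)"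
  unfolding partial_def by (metis frechet_derivative_at)

lemma partial_const [simp]: "partial i (\<lambda>q. c) p = 0"
  by (simp add: partial_eq[OF has_derivative_const])

lemma partial_cong:
  assumes "open U" "p \<in> U" "\<And>q. q \<in> U \<Longrightarrow> \<phi> q = \<psi> q"
  shows "partial i \<phi> p = partial i \<psi> p"
proof -
  have "(\<phi> has_derivative D) (at p) \<longleftrightarrow> (\<psi> has_derivative D) (at p)" for D
    using has_derivative_transform_within_open[OF _ assms(1,2)] assms(3) by metis
  then show ?thesis by (simp add: partial_def frechet_derivative_def)
qed

lemma partial_component:
  assumes "\<phi> differentiable (at p)"
  shows "partial i \<phi> p $ a = partial i (\<lambda>q. \<phi> q $ a) p"
proof -
  have "(\<phi> has_derivative frechet_derivative \<phi> (at p)) (at p)"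
    using assms by (simp add: frechet_derivative_works)
  then have "((\<lambda>q. \<phi> q $ a) has_derivative (\<lambda>v. frechet_derivative \<phi> (at p) v $ a)) (at p)"
    by (rule bounded_linear.has_derivative[OF bounded_linear_vec_nth])
  from partial_eq[OF this] show ?thesis by (simp add: partial_def)
qed

section \<open>Diagonal matrices\<close>

definition diag :: "('n \<Rightarrow> 'a::zero) \<Rightarrow> 'a^'n^'n" where
  "diag d = (\<chi> i j. if i = j then d i else 0)"

lemma diag_nth [simp]: "diag d $ i $ j = (if i = j then d i else 0)"
  by (simp add: diag_def)

lemma sum_diag: "(\<Sum>l\<in>UNIV. diag d $ i $ l * x l) = d i * x i"
  for d :: "'n::finite \<Rightarrow> 'a::semiring_1"
  by (simp add: if_distrib[where f = "\<lambda>x. x * _"] cong: if_cong)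

lemma matrix_mult_diag: "(diag d ** A) $ i $ j = d i * A $ i $ j"
  for A :: "'a::semiring_1^'n^'n"
  by (simp add: matrix_matrix_mult_def sum_diag del: diag_nth)

lemma matrix_inv_diag:
  fixes d :: "'n::finite \<Rightarrow> 'a::field"
  assumes "\<And>i. d i \<noteq> 0"
  shows "matrix_inv (diag d) = diag (\<lambda>i. inverse (d i))"
proof -
  have inv: "diag (\<lambda>i. inverse (d i)) ** diag d = mat 1" "diag d ** diag (\<lambda>i. inverse (d i)) = mat 1"
    using assms by (auto simp: vec_eq_iff matrix_mult_diag mat_def)
  \<comment> \<open>\<open>matrix_inv\<close> is a choice; the explicit two-sided inverse shows that
    the choice is a right inverse, and multiplying by the explicit one from the left identifies the
    two.\<close>
  then have "diag d ** matrix_inv (diag d) = mat 1"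
    unfolding matrix_inv_def
    by (rule_tac someI2[of _ "diag (\<lambda>i. inverse (d i))"]) auto
  then show ?thesis
    by (metis inv(1) matrix_mul_assoc matrix_mul_lid matrix_mul_rid)
qed

lemma det_diag: "det (diag d) = (\<Prod>i\<in>UNIV. d i)"
  by (subst det_diagonal) auto

text \<open>On the diagonal only the symbols \<open>\<Gamma>\<^sup>i\<^bsub>ik\<^esub> = \<partial>\<^sub>k g\<^bsub>ii\<^esub> / (2 g\<^bsub>ii\<^esub>)\<close> enter.\<close>

lemma hessian_operator_orthogonal:
  assumes U: "open U" "p \<in> U" and g: "\<And>q. q \<in> U \<Longrightarrow> metric X q = diag (\<lambda>i. G i q)"
    and nz: "\<And>q i. q \<in> U \<Longrightarrow> G i q \<noteq> 0"
  shows "hessian_operator X \<phi> p $ i $ i =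
    partial i (\<lambda>q. partial i \<phi> q / G i q) p
    + (\<Sum>k\<in>UNIV. partial k (G i) p * partial k \<phi> p / (2 * G i p * G k p))"
proof -
  have inv: "matrix_inv (metric X q) = diag (\<lambda>i. inverse (G i q))" if "q \<in> U" for q
    using matrix_inv_diag[OF nz] g that by simp
  have grad: "gradient X \<phi> q $ i = partial i \<phi> q / G i q" if "q \<in> U" for q i
    using inv[OF that]
    by (simp add: gradient_def sum_diag divide_inverse del: diag_nth)
  have g': "partial j (\<lambda>q. metric X q $ k $ l) p = (if k = l then partial j (G k) p else 0)" for j k l
    using partial_cong[OF U, of "\<lambda>q. metric X q $ k $ l" "\<lambda>q. if k = l then G k q else 0" j] g
    by (auto split: if_splits)
  have chr: "christoffel X p i i k = partial k (G i) p / (2 * G i p)" for k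
    unfolding christoffel_def g' inv[OF U(2)] sum_diag by (simp add: field_simps)
  have "partial i (\<lambda>q. gradient X \<phi> q $ i) p = partial i (\<lambda>q. partial i \<phi> q / G i q) p"
    by (rule partial_cong[OF U]) (rule grad)
  then show ?thesis
    unfolding hessian_operator_def by (simp add: grad[OF U(2)] chr)
qed

section \<open>Shape operator and first Newton transformation\<close>

lemma lorentz_sum_right: "lorentz v (\<Sum>i\<in>A. c i *\<^sub>R u i) = (\<Sum>i\<in>A. c i * lorentz v (u i))"
proof (induction A rule: infinite_finite_induct)
  case (insert x F)
  then show ?case by (simp add: lorentz_def algebra_simps)
qed (simp_all add: lorentz_def)

text \<open>The definite description requires uniqueness: pairing with each frame vector recovers
  every coefficient, since the frame is orthogonal and no \<open>d i\<close> vanishes, whatever its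
  sign.\<close>

lemma shape_operator_orthogonal:
  assumes g: "metric X p = diag d" and nz: "\<And>i. d i \<noteq> 0"
    and N: "\<And>j. - partial j N p = \<kappa> j *\<^sub>R partial j X p"
  shows "shape_operator X N p = diag \<kappa>"
proof -
  have lor: "lorentz (partial i X p) (partial j X p) = (if i = j then d i else 0)" for i j
    using arg_cong[OF g, of "\<lambda>A. A $ i $ j"] by (simp add: metric_def)
  have unique: "S = diag \<kappa>" if S: "\<forall>j. - partial j N p = (\<Sum>i\<in>UNIV. (S$i$j) *\<^sub>R partial i X p)" for S
  proof -
    have "S $ k $ j * d k = diag \<kappa> $ k $ j * d k" for k j
    proof -
      \<comment> \<open>The single term is written as a sum over \<open>{j}\<close> so that
        \<open>lorentz_sum_right\<close> expands both sides.\<close>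
      have "lorentz (partial k X p) (\<Sum>i\<in>UNIV. (S$i$j) *\<^sub>R partial i X p)
        = lorentz (partial k X p) (\<Sum>i\<in>{j}. \<kappa> i *\<^sub>R partial i X p)"
        using S[rule_format, of j] N[of j] by simp
      then show ?thesis
        unfolding lorentz_sum_right lor
        by (simp add: if_distrib[where f = "\<lambda>x. _ * x"] cong: if_cong split: if_splits)
    qed
    then show ?thesis using nz by (simp add: vec_eq_iff)
  qed
  have "- partial j N p = (\<Sum>i\<in>UNIV. (diag \<kappa>$i$j) *\<^sub>R partial i X p)" for j
    by (simp add: N if_distrib[where f = "\<lambda>x. x *\<^sub>R _"] cong: if_cong)
  then show ?thesis
    unfolding shape_operator_def by (rule the_equality[OF allI unique])
qed

text \<open>For \<open>c z = \<Prod>\<^sub>i (z - x\<^sub>i)\<close> the sum of the roots is \<open>c 0 - (c 1 + c (- 1)) / 2\<close>, whence it does not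
  depend on the choice of the roots.\<close>

lemma curv_coeff_diag: "curv_coeff (diag d) 1 = - (\<Sum>i\<in>UNIV. d i)"
proof -
  let ?P = "\<lambda>\<kappa> :: 3 \<Rightarrow> complex. \<forall>z. det (mat z - map_matrix complex_of_real (diag d)) = (\<Prod>i\<in>UNIV. z - \<kappa> i)"
  have "mat z - map_matrix complex_of_real (diag d) = diag (\<lambda>i. z - complex_of_real (d i))" for z
    by (simp add: vec_eq_iff mat_def)
  then have det: "det (mat z - map_matrix complex_of_real (diag d)) = (\<Prod>i\<in>UNIV. z - complex_of_real (d i))" for z
    by (simp add: det_diag)
  define \<kappa> where "\<kappa> = principal_curvatures (diag d)"
  \<comment> \<open>The diagonal entries are one admissible list of roots, so the predicate under
    the choice operator is satisfiable.\<close>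
  have "?P (\<lambda>i. complex_of_real (d i))" using det by blast
  then have "?P \<kappa>"
    unfolding \<kappa>_def principal_curvatures_def by (rule someI[of ?P])
  then have eq: "(\<Prod>i\<in>UNIV. z - complex_of_real (d i)) = (\<Prod>i\<in>UNIV. z - \<kappa> i)" for z
    using det by metis
  have prod: "(\<Prod>i\<in>UNIV. y i) = y 1 * y 2 * y 3" for y :: "3 \<Rightarrow> complex"
    unfolding UNIV_3 by (simp add: ac_simps)
  have sum: "2 * (\<Sum>i\<in>UNIV. x i) = 2 * (\<Prod>i\<in>UNIV. 0 - x i) - (\<Prod>i\<in>UNIV. 1 - x i) - (\<Prod>i\<in>UNIV. - 1 - x i)"
    for x :: "3 \<Rightarrow> complex"
    unfolding sum_3 prod by algebra
  have "2 * (\<Sum>i\<in>UNIV. \<kappa> i) = 2 * (\<Sum>i\<in>UNIV. complex_of_real (d i))"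
    unfolding sum eq ..
  then have "(\<Sum>i\<in>UNIV. \<kappa> i) = (\<Sum>i\<in>UNIV. complex_of_real (d i))"
    by simp
  moreover have "{A. card A = 1} = (\<lambda>i. {i}) ` (UNIV :: 3 set)"
    by (auto simp: card_1_singleton_iff)
  ultimately show ?thesis
    unfolding curv_coeff_def \<kappa>_def[symmetric] by (simp add: sum.reindex)
qed

text \<open>The first Newton transformation is S - (tr S) I. It is diagonal in the frame, so the
  trace sees only the diagonal of the Hessian operator.\<close>

lemma L_operator_1_orthogonal:
  assumes U: "open U" "p \<in> U" and g: "\<And>q. q \<in> U \<Longrightarrow> metric X q = diag (\<lambda>i. G i q)"
    and nz: "\<And>q i. q \<in> U \<Longrightarrow> G i q \<noteq> 0"
    and N: "\<And>j. - partial j N p = \<kappa> j *\<^sub>R partial j X p"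
  shows "L_operator 1 X N \<phi> p = (\<Sum>i\<in>UNIV. (\<kappa> i - (\<Sum>j\<in>UNIV. \<kappa> j)) *
    (partial i (\<lambda>q. partial i \<phi> q / G i q) p
     + (\<Sum>k\<in>UNIV. partial k (G i) p * partial k \<phi> p / (2 * G i p * G k p))))"
proof -
  have "newton_transformation (diag \<kappa>) 1 = diag (\<lambda>i. \<kappa> i - (\<Sum>j\<in>UNIV. \<kappa> j))"
    using curv_coeff_diag[of \<kappa>] by (auto simp: vec_eq_iff matrix_mult_diag) (simp_all add: mat_def)
  then show ?thesis
    unfolding L_operator_def shape_operator_orthogonal[OF g[OF U(2)] nz[OF U(2)] N] trace_def
    by (simp add: matrix_mult_diag hessian_operator_orthogonal[OF U g nz])
qed

section \<open>The rotational hypersurface\<close>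

text \<open>All components of the hypersurface and of its Gauss map, and all metric entries, have
  this form, so one derivative rule serves them all.\<close>

definition separable :: "(real \<Rightarrow> real) \<Rightarrow> (real \<Rightarrow> real) \<Rightarrow> (real \<Rightarrow> real) \<Rightarrow> real^3 \<Rightarrow> real" where
  "separable a b c q = a (q$1) * b (q$2) * c (q$3)"

lemma has_derivative_separable:
  assumes "(a has_real_derivative a') (at (p$1))" "(b has_real_derivative b') (at (p$2))"
    "(c has_real_derivative c') (at (p$3))"
  shows "(separable a b c has_derivative
    (\<lambda>v. a' * b (p$2) * c (p$3) * v$1 + a (p$1) * b' * c (p$3) * v$2 + a (p$1) * b (p$2) * c' * v$3)) (at p)"
proof -
  have nth: "((\<lambda>q. q $ i) has_derivative (\<lambda>v. v $ i)) (at p)" for i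
    by (rule bounded_linear_imp_has_derivative[OF bounded_linear_vec_nth])
  show ?thesis
    unfolding separable_def
    by (rule has_derivative_eq_rhs[OF has_derivative_mult[OF has_derivative_mult]])
      (rule DERIV_compose_FDERIV[OF assms(1) nth] DERIV_compose_FDERIV[OF assms(2) nth]
        DERIV_compose_FDERIV[OF assms(3) nth] | simp add: fun_eq_iff algebra_simps)+
qed

lemma partial_separable:
  assumes "(a has_real_derivative a') (at (p$1))" "(b has_real_derivative b') (at (p$2))"
    "(c has_real_derivative c') (at (p$3))"
  shows "partial 1 (separable a b c) p = a' * b (p$2) * c (p$3)"
    "partial 2 (separable a b c) p = a (p$1) * b' * c (p$3)"
    "partial 3 (separable a b c) p = a (p$1) * b (p$2) * c'"
  by (simp_all add: partial_eq[OF has_derivative_separable[OF assms]] axis_def)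

lemma smooth_on_nth: "open U \<Longrightarrow> smooth_on (\<lambda>q. q $ i) U"
  for U :: "(real^'n) set"
  by (rule smooth_on_bounded_linear[OF _ bounded_linear_vec_nth])

lemma smooth_on_profile:
  fixes U :: "(real^'n) set" and a :: "real \<Rightarrow> real"
  assumes "open U" "open I" "smooth_on a I" "(\<lambda>q. q $ i) ` U \<subseteq> I"
  shows "smooth_on (\<lambda>q. a (q$i)) U"
  by (rule smooth_on_compose[OF assms(1,2) smooth_on_nth[OF assms(1)] assms(3,4)])

lemma rot_hypersurface_nth:
  "(\<lambda>q. rot_hypersurface f q $ 1) = separable (\<lambda>s. s) cosh cosh"
  "(\<lambda>q. rot_hypersurface f q $ 2) = separable (\<lambda>s. s) sinh (\<lambda>w. 1)"
  "(\<lambda>q. rot_hypersurface f q $ 3) = separable (\<lambda>s. s) cosh sinh"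
  "(\<lambda>q. rot_hypersurface f q $ 4) = separable f (\<lambda>t. 1) (\<lambda>w. 1)"
  by (simp_all add: fun_eq_iff rot_hypersurface_def separable_def)

text \<open>Here \<open>a\<close>, \<open>b\<close>, \<open>c\<close> stand for f', f'', f'''. The
  left side is what \<open>L_operator_separable\<close> yields for \<open>h\<close> = - f' / W and
  \<mu> = 2. Replacing \<open>a\<^sup>2 - 1\<close> by \<open>- W\<^sup>2\<close> allows a common
  denominator; the relation between \<open>W\<close> and \<open>a\<close> then settles the
  polynomial identity of the numerators.\<close>

lemma spatial_identity:
  fixes a b c s W :: real
  assumes "s \<noteq> 0" "W \<noteq> 0" "W\<^sup>2 = 1 - a\<^sup>2"
  shows "- (2 * (a / (s * W)) * ((c / W ^ 5 + 5 * a * b * b / W ^ 7) + a * b * (- (b / W ^ 3)) / (a\<^sup>2 - 1)\<^sup>2)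
      + (b / W ^ 3 + a / (s * W)) * (2 * (- (a / W)) / s\<^sup>2 + 2 * (- (b / W ^ 3)) / (s * (a\<^sup>2 - 1))))
    = - (2 * (a\<^sup>2 - 1) ^ 3 * a\<^sup>2 - 2 * s * (a\<^sup>2 - 1) * a ^ 3 * b
         + 2 * s\<^sup>2 * (4 * a\<^sup>2 + 1) * b\<^sup>2 - 2 * s\<^sup>2 * (a\<^sup>2 - 1) * a * c) / (s ^ 3 * W ^ 8)" (is "?L = - ?Q / _")
proof -
  have a: "a\<^sup>2 - 1 = - W\<^sup>2" using assms(3) by simp
  \<comment> \<open>The coefficient 8 is 2 (5 - 1): 5 comes from differentiating the power of W, -1
    from the Christoffel term. The product is the curvature sum times the remaining bracket.\<close>
  have "?L = (- (2 * s\<^sup>2 * a * W\<^sup>2 * c + 8 * s\<^sup>2 * a\<^sup>2 * b\<^sup>2)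
      - 2 * (s * b + a * W\<^sup>2) * (s * b - a * W ^ 4)) / (s ^ 3 * W ^ 8)"
    unfolding a using assms(1,2) by (simp add: field_simps) algebra
  also have "- (2 * s\<^sup>2 * a * W\<^sup>2 * c + 8 * s\<^sup>2 * a\<^sup>2 * b\<^sup>2)
      - 2 * (s * b + a * W\<^sup>2) * (s * b - a * W ^ 4) = - ?Q"
    using assms(3) by algebra
  finally show ?thesis .
qed

text \<open>The counterpart for \<open>h\<close> = - 1 / W and \<mu> = 0; the vanishing summand
  stays so that the left side matches that instance literally.\<close>

lemma axial_identity:
  fixes a b c s W :: real
  assumes "s \<noteq> 0" "W \<noteq> 0" "W\<^sup>2 = 1 - a\<^sup>2"
  shows "- (2 * (a / (s * W)) * (((b * b + c * a) / W ^ 5 + 5 * a * b * (a * b) / W ^ 7) + a * b * (- (a * b / W ^ 3)) / (a\<^sup>2 - 1)\<^sup>2)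
      + (b / W ^ 3 + a / (s * W)) * (0 * (- (1 / W)) / s\<^sup>2 + 2 * (- (a * b / W ^ 3)) / (s * (a\<^sup>2 - 1))))
    = 2 * a * (s * (a\<^sup>2 - 1) * a * c + ((a\<^sup>2 - 1) * a - s * (3 * a\<^sup>2 + 2) * b) * b) / (s\<^sup>2 * W ^ 8)"
    (is "?L = 2 * a * ?R / _")
proof -
  have a: "a\<^sup>2 - 1 = - W\<^sup>2" using assms(3) by simp
  have "?L = 2 * a * (- (s * W\<^sup>2 * (b\<^sup>2 + a * c)) - 4 * s * a\<^sup>2 * b\<^sup>2 - (s * b + a * W\<^sup>2) * b) / (s\<^sup>2 * W ^ 8)"
    unfolding a using assms(1,2) by (simp add: field_simps) algebra
  also have "- (s * W\<^sup>2 * (b\<^sup>2 + a * c)) - 4 * s * a\<^sup>2 * b\<^sup>2 - (s * b + a * W\<^sup>2) * b = ?R"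
    using assms(3) by algebra
  finally show ?thesis .
qed

section \<open>The profile curve and its derivatives\<close>

locale rotational_profile =
  fixes I :: "real set" and f :: "real \<Rightarrow> real"
  assumes open_I: "open I" and zero_notin_I: "0 \<notin> I" and smooth_f: "smooth_on f I"
    and deriv_less_1: "s \<in> I \<Longrightarrow> (deriv f s)\<^sup>2 < 1"
begin

abbreviation "f1 \<equiv> deriv f"
abbreviation "f2 \<equiv> deriv (deriv f)"
abbreviation "f3 \<equiv> deriv (deriv (deriv f))"

definition W :: "real \<Rightarrow> real" where "W s = sqrt (1 - (f1 s)\<^sup>2)"

lemma W_pos: "s \<in> I \<Longrightarrow> W s > 0"
  using deriv_less_1 by (simp add: W_def)

lemma W_sq: "s \<in> I \<Longrightarrow> (W s)\<^sup>2 = 1 - (f1 s)\<^sup>2"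
  using deriv_less_1[of s] by (simp add: W_def)

lemma smooth_derivs: "smooth_on f1 I" "smooth_on f2 I" "smooth_on f3 I"
  using smooth_on_deriv(1)[OF open_I] smooth_f by blast+

lemma DERIV_f:
  "s \<in> I \<Longrightarrow> (f has_real_derivative f1 s) (at s)"
  "s \<in> I \<Longrightarrow> (f1 has_real_derivative f2 s) (at s)"
  "s \<in> I \<Longrightarrow> (f2 has_real_derivative f3 s) (at s)"
  using smooth_on_deriv(2)[OF open_I] smooth_f smooth_derivs by blast+

lemma DERIV_W:
  assumes "s \<in> I"
  shows "(W has_real_derivative - (f1 s * f2 s / W s)) (at s)"
proof -
  have D: "((\<lambda>s. 1 - (f1 s)\<^sup>2) has_real_derivative - (2 * f1 s * f2 s)) (at s)"
    using DERIV_f(2)[OF assms] by (auto intro!: derivative_eq_intros)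
  have pos: "1 - (f1 s)\<^sup>2 > 0" using deriv_less_1[OF assms] by simp
  show ?thesis
    unfolding W_def[abs_def]
    by (rule DERIV_cong[OF DERIV_chain2[where g = "\<lambda>s. 1 - (f1 s)\<^sup>2", OF DERIV_real_sqrt[OF pos] D]])
      (simp add: inverse_eq_divide)
qed

lemma smooth_W: "smooth_on W I"
  unfolding W_def[abs_def]
  by (intro smooth_on_sqrt smooth_on_diff smooth_on_power smooth_on_const smooth_derivs open_I)
    (use deriv_less_1 in simp)

lemma rot_Gauss_map_nth:
  "(\<lambda>q. rot_Gauss_map f q $ 1) = separable (\<lambda>s. - (f1 s / W s)) cosh cosh"
  "(\<lambda>q. rot_Gauss_map f q $ 2) = separable (\<lambda>s. - (f1 s / W s)) sinh (\<lambda>w. 1)"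
  "(\<lambda>q. rot_Gauss_map f q $ 3) = separable (\<lambda>s. - (f1 s / W s)) cosh sinh"
  "(\<lambda>q. rot_Gauss_map f q $ 4) = separable (\<lambda>s. - (1 / W s)) (\<lambda>t. 1) (\<lambda>w. 1)"
  by (simp_all add: fun_eq_iff rot_Gauss_map_def separable_def W_def)

lemma open_rot_domain: "open (rot_domain I)"
proof -
  have "rot_domain I = (\<lambda>p. p $ 1) -` I" by (auto simp: rot_domain_def)
  then show ?thesis using open_I by (simp add: open_vimage continuous_on_component)
qed

lemma smooth_separable:
  assumes "smooth_on a I" "smooth_on b UNIV" "smooth_on c UNIV"
  shows "smooth_on (separable a b c) (rot_domain I)"
  unfolding separable_def[abs_def]
  by (intro smooth_on_mult open_rot_domain smooth_on_profile[OF open_rot_domain open_I assms(1)]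
      smooth_on_profile[OF open_rot_domain open_UNIV assms(2)]
      smooth_on_profile[OF open_rot_domain open_UNIV assms(3)]) (auto simp: rot_domain_def)

lemma smooth_rot_hypersurface: "smooth_on (rot_hypersurface f) (rot_domain I)"
proof (rule smooth_on_vec[OF open_rot_domain])
  fix i :: 4
  have "smooth_on (\<lambda>s::real. s) I"
    by (rule smooth_on_bounded_linear[OF open_I bounded_linear_ident])
  then show "smooth_on (\<lambda>q. rot_hypersurface f q $ i) (rot_domain I)"
    using exhaust_4[of i] smooth_f smooth_on_cosh_sinh smooth_on_const[OF open_UNIV]
    by (auto simp: rot_hypersurface_nth intro!: smooth_separable)
qed

lemma smooth_rot_Gauss_map: "smooth_on (rot_Gauss_map f) (rot_domain I)"
proof (rule smooth_on_vec[OF open_rot_domain])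
  fix i :: 4
  have "smooth_on (\<lambda>s. (-1) * (a s / W s)) I" if "smooth_on a I" for a
    using that W_pos
    by (intro smooth_on_mult smooth_on_divide smooth_W open_I smooth_on_const) (auto simp: less_le)
  from this[OF smooth_derivs(1)] this[OF smooth_on_const[OF open_I, of 1]]
  show "smooth_on (\<lambda>q. rot_Gauss_map f q $ i) (rot_domain I)"
    using exhaust_4[of i] smooth_on_cosh_sinh smooth_on_const[OF open_UNIV]
    by (auto simp: rot_Gauss_map_nth intro!: smooth_separable)
qed

lemma DERIV_inverse_W:
  assumes "s \<in> I"
  shows "((\<lambda>s. - (1 / W s)) has_real_derivative - (f1 s * f2 s / W s ^ 3)) (at s)"
  by (rule DERIV_cong[OF DERIV_minus[OF DERIV_divide[OF DERIV_const DERIV_W[OF assms]]]])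
    (use W_pos[OF assms] in \<open>simp_all add: field_simps power3_eq_cube\<close>)

text \<open>In the quotient rule the numerator is f'' (W^2 + f'^2) up to a factor W, and the bracket
  equals 1.\<close>

lemma DERIV_f1_over_W:
  assumes "s \<in> I"
  shows "((\<lambda>s. - (f1 s / W s)) has_real_derivative - (f2 s / W s ^ 3)) (at s)"
proof -
  have "f2 s * (W s)\<^sup>2 + f1 s * (f1 s * f2 s) = f2 s"
    unfolding W_sq[OF assms] by (simp add: algebra_simps power2_eq_square)
  then have "(f2 s * W s - f1 s * (- (f1 s * f2 s / W s))) / (W s * W s) = f2 s / W s ^ 3"
    using W_pos[OF assms] by (simp add: field_simps power2_eq_square power3_eq_cube)
  then show ?thesis
    by (intro DERIV_minus) (use DERIV_divide[OF DERIV_f(2)[OF assms] DERIV_W[OF assms]] W_pos[OF assms] in auto)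
qed

lemma DERIV_cosh_sinh:
  "(cosh has_real_derivative sinh t) (at t)" "(sinh has_real_derivative cosh t) (at t)" for t :: real
  by (auto intro!: derivative_eq_intros)

text \<open>Rewrite rules eliminating squares of cosh; the second catches the square inside a
  right-nested product.\<close>

lemma cosh_mult_cosh:
  "cosh x * cosh x = 1 + sinh x * sinh x" "cosh x * (cosh x * y) = y + sinh x * (sinh x * y)" for x y :: real
proof -
  show *: "cosh x * cosh x = 1 + sinh x * sinh x"
    using cosh_square_eq[of x] by (simp add: power2_eq_square)
  then show "cosh x * (cosh x * y) = y + sinh x * (sinh x * y)"
    by (metis distrib_right mult.assoc mult_1)
qed

section \<open>Frame, metric and shape operator of the rotational hypersurface\<close>

lemma partial_rot_hypersurface:
  assumes "p \<in> rot_domain I"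
  shows "partial 1 (rot_hypersurface f) p =
      vector [cosh (p$2) * cosh (p$3), sinh (p$2), cosh (p$2) * sinh (p$3), f1 (p$1)]"
    "partial 2 (rot_hypersurface f) p =
      vector [p$1 * sinh (p$2) * cosh (p$3), p$1 * cosh (p$2), p$1 * sinh (p$2) * sinh (p$3), 0]"
    "partial 3 (rot_hypersurface f) p =
      vector [p$1 * cosh (p$2) * sinh (p$3), 0, p$1 * cosh (p$2) * cosh (p$3), 0]"
proof -
  have s: "p$1 \<in> I" using assms by (simp add: rot_domain_def)
  note comp = partial_component[OF smooth_on_imp_differentiable[OF open_rot_domain smooth_rot_hypersurface assms]]
  note sep = partial_separable[OF DERIV_ident DERIV_cosh_sinh(1) DERIV_cosh_sinh(1)]
    partial_separable[OF DERIV_ident DERIV_cosh_sinh(2) DERIV_const]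
    partial_separable[OF DERIV_ident DERIV_cosh_sinh(1) DERIV_cosh_sinh(2)]
    partial_separable[OF DERIV_f(1)[OF s] DERIV_const DERIV_const]
  show "partial 1 (rot_hypersurface f) p =
      vector [cosh (p$2) * cosh (p$3), sinh (p$2), cosh (p$2) * sinh (p$3), f1 (p$1)]"
    "partial 2 (rot_hypersurface f) p =
      vector [p$1 * sinh (p$2) * cosh (p$3), p$1 * cosh (p$2), p$1 * sinh (p$2) * sinh (p$3), 0]"
    "partial 3 (rot_hypersurface f) p =
      vector [p$1 * cosh (p$2) * sinh (p$3), 0, p$1 * cosh (p$2) * cosh (p$3), 0]"
    by (simp_all add: vec_eq_iff forall_4 comp rot_hypersurface_nth sep)
qed

definition \<kappa> :: "real \<Rightarrow> 3 \<Rightarrow> real" where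
  "\<kappa> s i = (if i = 1 then f2 s / W s ^ 3 else f1 s / (s * W s))"

text \<open>Along t and w only the factor in front of E counts, - f' / W against s, and the fourth
  components are constant. Along s the derivatives of - f' / W and - 1 / W are - f'' / W^3 times 1
  and f', the corresponding entries of the tangent vector.\<close>

lemma partial_rot_Gauss_map:
  assumes "p \<in> rot_domain I"
  shows "- partial j (rot_Gauss_map f) p = \<kappa> (p$1) j *\<^sub>R partial j (rot_hypersurface f) p"
proof -
  have s: "p$1 \<in> I" "p$1 \<noteq> 0" using assms zero_notin_I by (auto simp: rot_domain_def)
  note comp = partial_component[OF smooth_on_imp_differentiable[OF open_rot_domain smooth_rot_Gauss_map assms]]
  note sep = partial_separable[OF DERIV_f1_over_W[OF s(1)] DERIV_cosh_sinh(1) DERIV_cosh_sinh(1)]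
    partial_separable[OF DERIV_f1_over_W[OF s(1)] DERIV_cosh_sinh(2) DERIV_const]
    partial_separable[OF DERIV_f1_over_W[OF s(1)] DERIV_cosh_sinh(1) DERIV_cosh_sinh(2)]
    partial_separable[OF DERIV_inverse_W[OF s(1)] DERIV_const DERIV_const]
  show ?thesis
    using exhaust_3[of j] s(2) W_pos[OF s(1)]
    by (auto simp: vec_eq_iff forall_4 comp rot_Gauss_map_nth sep \<kappa>_def
        partial_rot_hypersurface[OF assms] field_simps)
qed

definition G :: "3 \<Rightarrow> real^3 \<Rightarrow> real" where
  "G i = separable (\<lambda>s. if i = 1 then (f1 s)\<^sup>2 - 1 else s\<^sup>2) (\<lambda>t. if i = 3 then (cosh t)\<^sup>2 else 1) (\<lambda>w. 1)"

lemma metric_rot_hypersurface: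
  assumes "p \<in> rot_domain I"
  shows "metric (rot_hypersurface f) p = diag (\<lambda>i. G i p)"
  by (simp add: vec_eq_iff forall_3 metric_def lorentz_def partial_rot_hypersurface[OF assms]
      G_def separable_def power2_eq_square algebra_simps cosh_mult_cosh)

lemma G_nonzero:
  assumes "p \<in> rot_domain I"
  shows "G i p \<noteq> 0"
  using assms deriv_less_1[of "p$1"] zero_notin_I
  by (auto simp: G_def separable_def rot_domain_def)

lemma oriented_rot_hypersurface:
  "oriented_hypersurface (rot_domain I) (rot_hypersurface f) (rot_Gauss_map f)"
proof -
  have N: "rot_Gauss_map f p = - (1 / W (p$1)) *\<^sub>R
       vector [f1 (p$1) * cosh (p$2) * cosh (p$3), f1 (p$1) * sinh (p$2),
               f1 (p$1) * cosh (p$2) * sinh (p$3), 1]" for p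
    by (simp add: rot_Gauss_map_def W_def)
  have scale: "lorentz (c *\<^sub>R x) y = c * lorentz x y" "lorentz y (c *\<^sub>R x) = c * lorentz y x" for c x y
    by (simp_all add: lorentz_def algebra_simps)
  \<comment> \<open>The normal is spacelike, \<epsilon> = 1: before normalization its square is 1 -
    f'^2, which is W^2.\<close>
  have "lorentz (rot_Gauss_map f p) (rot_Gauss_map f p) = 1" if "p \<in> rot_domain I" for p
  proof -
    have s: "p$1 \<in> I" using that by (simp add: rot_domain_def)
    have "lorentz v v = 1 - (f1 (p$1))\<^sup>2"
      if "v = vector [f1 (p$1) * cosh (p$2) * cosh (p$3), f1 (p$1) * sinh (p$2),
               f1 (p$1) * cosh (p$2) * sinh (p$3), 1]" for v
      unfolding that by (simp add: lorentz_def power2_eq_square algebra_simps cosh_mult_cosh)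
    then have "lorentz (rot_Gauss_map f p) (rot_Gauss_map f p) = (1 - (f1 (p$1))\<^sup>2) / (W (p$1))\<^sup>2"
      unfolding N scale by (simp add: power2_eq_square)
    then show ?thesis using W_pos[OF s] by (simp flip: W_sq[OF s])
  qed
  moreover have "lorentz (rot_Gauss_map f p) (partial i (rot_hypersurface f) p) = 0"
    if "p \<in> rot_domain I" for p i
  proof -
    have "lorentz v (partial i (rot_hypersurface f) p) = 0"
      if "v = vector [f1 (p$1) * cosh (p$2) * cosh (p$3), f1 (p$1) * sinh (p$2),
               f1 (p$1) * cosh (p$2) * sinh (p$3), 1]" for v
      unfolding that using exhaust_3[of i]
      by (auto simp: lorentz_def partial_rot_hypersurface[OF \<open>p \<in> rot_domain I\<close>] algebra_simps cosh_mult_cosh)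
    then show ?thesis unfolding N scale by simp
  qed
  ultimately show ?thesis
    unfolding oriented_hypersurface_def
    using open_rot_domain smooth_rot_hypersurface smooth_rot_Gauss_map
    by (auto simp: metric_rot_hypersurface det_diag G_nonzero)
qed

text \<open>The hypothesis on \<open>\<mu>\<close> says that \<open>a(t) b(w)\<close> is an eigenfunction, at \<open>p\<close>, of the Laplacian
  \<open>\<partial>\<^sub>t\<^sup>2 + tanh t \<partial>\<^sub>t + (cosh t)\<^sup>-\<^sup>2 \<partial>\<^sub>w\<^sup>2\<close> of the hyperbolic plane.\<close>

lemma L_operator_separable:
  assumes p: "p \<in> rot_domain I"
    and h: "\<And>s. s \<in> I \<Longrightarrow> (h has_real_derivative h' s) (at s)"
    and k: "((\<lambda>s. h' s / ((f1 s)\<^sup>2 - 1)) has_real_derivative k) (at (p$1))"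
    and a: "\<And>t. (a has_real_derivative a' t) (at t)" "(a' has_real_derivative a'') (at (p$2))"
    and b: "\<And>w. (b has_real_derivative b' w) (at w)" "(b' has_real_derivative b'') (at (p$3))"
    and \<mu>: "a'' * b (p$3) + a' (p$2) * b (p$3) * sinh (p$2) / cosh (p$2) + a (p$2) * b'' / (cosh (p$2))\<^sup>2
      = \<mu> * a (p$2) * b (p$3)"
  shows "L_operator 1 (rot_hypersurface f) (rot_Gauss_map f) (separable h a b) p =
    - (2 * \<kappa> (p$1) 2 * (k + f1 (p$1) * f2 (p$1) * h' (p$1) / ((f1 (p$1))\<^sup>2 - 1)\<^sup>2)
      + (\<kappa> (p$1) 1 + \<kappa> (p$1) 2) *
        (\<mu> * h (p$1) / (p$1)\<^sup>2 + 2 * h' (p$1) / (p$1 * ((f1 (p$1))\<^sup>2 - 1)))) * a (p$2) * b (p$3)"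
proof -
  let ?X = "rot_hypersurface f" and ?N = "rot_Gauss_map f" and ?\<phi> = "separable h a b"
  define s t w where "s = p$1" and "t = p$2" and "w = p$3"
  have s: "s \<in> I" "s \<noteq> 0" using p zero_notin_I by (auto simp: rot_domain_def s_def)
  have c: "cosh t > 0" by simp
  have g: "(f1 s)\<^sup>2 - 1 \<noteq> 0" using deriv_less_1[OF s(1)] by simp
  have d: "partial 1 ?\<phi> q = h' (q$1) * a (q$2) * b (q$3)"
    "partial 2 ?\<phi> q = h (q$1) * a' (q$2) * b (q$3)"
    "partial 3 ?\<phi> q = h (q$1) * a (q$2) * b' (q$3)" if "q \<in> rot_domain I" for q
    using that partial_separable[OF h a(1) b(1), of q] by (auto simp: rot_domain_def)
  have hs: "((\<lambda>s. h s / s\<^sup>2) has_real_derivative (h' s * s\<^sup>2 - h s * (2 * s)) / (s\<^sup>2 * s\<^sup>2)) (at s)"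
    using s by (auto intro!: derivative_eq_intros h)
  have ac: "((\<lambda>t. a t / (cosh t)\<^sup>2) has_real_derivative
      (a' t * (cosh t)\<^sup>2 - a t * (2 * cosh t * sinh t)) / ((cosh t)\<^sup>2 * (cosh t)\<^sup>2)) (at t)"
    by (auto intro!: derivative_eq_intros a)
  \<comment> \<open>On the open domain each quotient of a first derivative by a metric entry is
    again separable, so the second derivatives reduce to one-variable ones.\<close>
  have "partial 1 (\<lambda>q. partial 1 ?\<phi> q / G 1 q) p
      = partial 1 (separable (\<lambda>s. h' s / ((f1 s)\<^sup>2 - 1)) a b) p"
    by (rule partial_cong[OF open_rot_domain p]) (simp add: d G_def separable_def)
  then have H1: "partial 1 (\<lambda>q. partial 1 ?\<phi> q / G 1 q) p = k * a t * b w"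
    by (simp add: partial_separable[OF k a(1) b(1)] t_def w_def)
  have "partial 2 (\<lambda>q. partial 2 ?\<phi> q / G 2 q) p = partial 2 (separable (\<lambda>s. h s / s\<^sup>2) a' b) p"
    by (rule partial_cong[OF open_rot_domain p]) (simp add: d G_def separable_def)
  then have H2: "partial 2 (\<lambda>q. partial 2 ?\<phi> q / G 2 q) p = h s / s\<^sup>2 * a'' * b w"
    by (simp add: partial_separable[OF hs[unfolded s_def] a(2) b(1)] s_def t_def w_def)
  have "partial 3 (\<lambda>q. partial 3 ?\<phi> q / G 3 q) p
      = partial 3 (separable (\<lambda>s. h s / s\<^sup>2) (\<lambda>t. a t / (cosh t)\<^sup>2) b') p"
    by (rule partial_cong[OF open_rot_domain p]) (simp add: d G_def separable_def)
  then have H3: "partial 3 (\<lambda>q. partial 3 ?\<phi> q / G 3 q) p = h s / s\<^sup>2 * (a t / (cosh t)\<^sup>2) * b''"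
    by (simp add: partial_separable[OF hs[unfolded s_def] ac[unfolded t_def] b(2)] s_def t_def w_def)
  have G1: "((\<lambda>s. (f1 s)\<^sup>2 - 1) has_real_derivative 2 * f1 s * f2 s) (at s)"
    by (auto intro!: derivative_eq_intros DERIV_f s)
  have G2: "((\<lambda>s. s\<^sup>2) has_real_derivative 2 * s) (at s)"
    by (auto intro!: derivative_eq_intros)
  have G3: "((\<lambda>t. (cosh t)\<^sup>2) has_real_derivative 2 * cosh t * sinh t) (at t)"
    by (auto intro!: derivative_eq_intros)
  have dG: "partial 1 (G 1) p = 2 * f1 s * f2 s" "partial 2 (G 1) p = 0" "partial 3 (G 1) p = 0"
    "partial 1 (G 2) p = 2 * s" "partial 2 (G 2) p = 0" "partial 3 (G 2) p = 0"
    "partial 1 (G 3) p = 2 * s * (cosh t)\<^sup>2" "partial 2 (G 3) p = s\<^sup>2 * (2 * cosh t * sinh t)" "partial 3 (G 3) p = 0"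
    by (simp_all add: G_def s_def t_def partial_separable[OF G1[unfolded s_def] DERIV_const DERIV_const]
        partial_separable[OF G2[unfolded s_def] DERIV_const DERIV_const]
        partial_separable[OF G2[unfolded s_def] G3[unfolded t_def] DERIV_const])
  have G: "G 1 p = (f1 s)\<^sup>2 - 1" "G 2 p = s\<^sup>2" "G 3 p = s\<^sup>2 * (cosh t)\<^sup>2"
    by (simp_all add: G_def separable_def s_def t_def)
  have \<kappa>3: "\<kappa> s 3 = \<kappa> s 2" by (simp add: \<kappa>_def)
  \<comment> \<open>For curvatures x, y, y the first Newton transformation has eigenvalues - 2 y, -
    (x + y), - (x + y).\<close>
  have lin: "(x - (x + y + y)) * A + (y - (x + y + y)) * B + (y - (x + y + y)) * C
      = - (2 * y) * A - (x + y) * B - (x + y) * C" for x y A B C :: real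
    by algebra
  define g1 where "g1 = (f1 s)\<^sup>2 - 1"
  have L: "L_operator 1 ?X ?N ?\<phi> p = (\<Sum>i\<in>UNIV. (\<kappa> (p$1) i - (\<Sum>j\<in>UNIV. \<kappa> (p$1) j)) *
    (partial i (\<lambda>q. partial i ?\<phi> q / G i q) p
     + (\<Sum>k\<in>UNIV. partial k (G i) p * partial k ?\<phi> p / (2 * G i p * G k p))))"
    by (rule L_operator_1_orthogonal[OF open_rot_domain p metric_rot_hypersurface G_nonzero
          partial_rot_Gauss_map[OF p]])
  \<comment> \<open>By \<open>dG\<close> one Christoffel term along s survives for each index, and
    for the third index also one along t, the source of tanh t.\<close>
  have "L_operator 1 ?X ?N ?\<phi> p =
    - (2 * \<kappa> s 2) * (k * a t * b w + 2 * f1 s * f2 s * (h' s * a t * b w) / (2 * g1 * g1))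
    - (\<kappa> s 1 + \<kappa> s 2) * (h s / s\<^sup>2 * a'' * b w + 2 * s * (h' s * a t * b w) / (2 * s\<^sup>2 * g1))
    - (\<kappa> s 1 + \<kappa> s 2) * (h s / s\<^sup>2 * (a t / (cosh t)\<^sup>2) * b''
        + 2 * s * (cosh t)\<^sup>2 * (h' s * a t * b w) / (2 * (s\<^sup>2 * (cosh t)\<^sup>2) * g1)
        + s\<^sup>2 * (2 * cosh t * sinh t) * (h s * a' t * b w) / (2 * (s\<^sup>2 * (cosh t)\<^sup>2) * s\<^sup>2))"
    unfolding L sum_3 H1 H2 H3 dG d[OF p] G g1_def[symmetric] s_def[symmetric] t_def[symmetric] w_def[symmetric] \<kappa>3 lin
    by simp
  \<comment> \<open>After cancellation the terms with h / s^2 form the hyperbolic Laplacian, to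
    which \<mu> applies; the equal contributions along s from the second and third index give the
    factor 2.\<close>
  also have "\<dots> = - (2 * \<kappa> s 2) * (k + f1 s * f2 s * h' s / g1\<^sup>2) * a t * b w
    - (\<kappa> s 1 + \<kappa> s 2) * (h s / s\<^sup>2 * (a'' * b w + a' t * b w * sinh t / cosh t + a t * b'' / (cosh t)\<^sup>2)
        + 2 * (h' s / (s * g1)) * a t * b w)"
  proof -
    have 1: "2 * f1 s * f2 s * (h' s * a t * b w) / (2 * g1 * g1) = f1 s * f2 s * h' s / g1\<^sup>2 * a t * b w"
      by (simp add: power2_eq_square)
    have 2: "2 * s * (h' s * a t * b w) / (2 * s\<^sup>2 * g1) = h' s / (s * g1) * a t * b w"
      using s(2) by (simp add: power2_eq_square)
    have 3: "2 * s * (cosh t)\<^sup>2 * (h' s * a t * b w) / (2 * (s\<^sup>2 * (cosh t)\<^sup>2) * g1) = h' s / (s * g1) * a t * b w"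
      using s(2) c by (simp add: power2_eq_square)
    have 4: "s\<^sup>2 * (2 * cosh t * sinh t) * (h s * a' t * b w) / (2 * (s\<^sup>2 * (cosh t)\<^sup>2) * s\<^sup>2)
        = h s / s\<^sup>2 * (a' t * b w * sinh t / cosh t)"
      using s(2) c by (simp add: power2_eq_square mult_ac)
    show ?thesis unfolding 1 2 3 4 by algebra
  qed
  also have "\<dots> = - (2 * \<kappa> s 2 * (k + f1 s * f2 s * h' s / g1\<^sup>2)
      + (\<kappa> s 1 + \<kappa> s 2) * (\<mu> * (h s / s\<^sup>2) + 2 * (h' s / (s * g1)))) * a t * b w"
    unfolding \<mu>[folded t_def w_def] by algebra
  finally show ?thesis unfolding s_def t_def w_def g1_def by simp
qed

text \<open>Both radial factors have a derivative - g / W^3, with g = f'' or g = f' f''. As f'^2 - 1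
  = - W^2 on \<open>I\<close>, dividing by the metric entry leaves g / W^5, which is differentiated
  instead.\<close>

lemma DERIV_over_W5:
  assumes "s \<in> I" "(g has_real_derivative g') (at s)"
  shows "((\<lambda>s. - (g s / W s ^ 3) / ((f1 s)\<^sup>2 - 1)) has_real_derivative
    g' / W s ^ 5 + 5 * f1 s * f2 s * g s / W s ^ 7) (at s)"
proof (rule has_field_derivative_transform_within_open[OF _ open_I assms(1)])
  have W: "W s \<noteq> 0" using W_pos[OF assms(1)] by simp
  have "((\<lambda>s. W s ^ 5) has_real_derivative 5 * W s ^ 4 * (- (f1 s * f2 s / W s))) (at s)"
    by (auto intro!: derivative_eq_intros DERIV_W[OF assms(1)])
  from DERIV_divide[OF assms(2) this] W
  show "((\<lambda>s. g s / W s ^ 5) has_real_derivative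
    g' / W s ^ 5 + 5 * f1 s * f2 s * g s / W s ^ 7) (at s)"
    by (rule_tac DERIV_cong) (auto simp: field_simps eval_nat_numeral)
  show "g x / W x ^ 5 = - (g x / W x ^ 3) / ((f1 x)\<^sup>2 - 1)" if "x \<in> I" for x
  proof -
    have "(f1 x)\<^sup>2 - 1 = - (W x)\<^sup>2" using W_sq[OF that] by simp
    then show ?thesis by (simp flip: power_add)
  qed
qed

section \<open>The components of L_1 N\<close>

definition Q :: "real \<Rightarrow> real" where
  "Q s = 2 * ((f1 s)\<^sup>2 - 1)^3 * (f1 s)\<^sup>2 - 2 * s * ((f1 s)\<^sup>2 - 1) * (f1 s)^3 * f2 s
         + 2 * s\<^sup>2 * (4 * (f1 s)\<^sup>2 + 1) * (f2 s)\<^sup>2 - 2 * s\<^sup>2 * ((f1 s)\<^sup>2 - 1) * f1 s * f3 s"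

definition R :: "real \<Rightarrow> real" where
  "R s = s * ((f1 s)\<^sup>2 - 1) * f1 s * f3 s
         + (((f1 s)\<^sup>2 - 1) * f1 s - s * (3 * (f1 s)\<^sup>2 + 2) * f2 s) * f2 s"

lemma \<kappa>_nth: "\<kappa> s 1 = f2 s / W s ^ 3" "\<kappa> s 2 = f1 s / (s * W s)"
  by (simp_all add: \<kappa>_def)

lemma L_operator_spatial:
  assumes p: "p \<in> rot_domain I"
    and a: "\<And>t. (a has_real_derivative a' t) (at t)" "(a' has_real_derivative a'') (at (p$2))"
    and b: "\<And>w. (b has_real_derivative b' w) (at w)" "(b' has_real_derivative b'') (at (p$3))"
    and \<mu>: "a'' * b (p$3) + a' (p$2) * b (p$3) * sinh (p$2) / cosh (p$2) + a (p$2) * b'' / (cosh (p$2))\<^sup>2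
      = 2 * a (p$2) * b (p$3)"
  shows "L_operator 1 (rot_hypersurface f) (rot_Gauss_map f) (separable (\<lambda>s. - (f1 s / W s)) a b) p =
    - Q (p$1) / (p$1 ^ 3 * W (p$1) ^ 8) * a (p$2) * b (p$3)"
proof -
  have s: "p$1 \<in> I" "p$1 \<noteq> 0" using p zero_notin_I by (auto simp: rot_domain_def)
  have W: "W (p$1) \<noteq> 0" using W_pos[OF s(1)] by simp
  note D = DERIV_over_W5[OF s(1) DERIV_f(3)[OF s(1)]]
  show ?thesis
    using L_operator_separable[OF p DERIV_f1_over_W D a b \<mu>]
    unfolding \<kappa>_nth spatial_identity[OF s(2) W W_sq[OF s(1)]] Q_def .
qed

lemma L_operator_axial:
  assumes p: "p \<in> rot_domain I"
  shows "L_operator 1 (rot_hypersurface f) (rot_Gauss_map f) (separable (\<lambda>s. - (1 / W s)) (\<lambda>t. 1) (\<lambda>w. 1)) p =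
    2 * f1 (p$1) * R (p$1) / ((p$1)\<^sup>2 * W (p$1) ^ 8)"
proof -
  have s: "p$1 \<in> I" "p$1 \<noteq> 0" using p zero_notin_I by (auto simp: rot_domain_def)
  note D = DERIV_over_W5[OF s(1) DERIV_mult[OF DERIV_f(2,3)[OF s(1)]]]
  have W: "W (p$1) \<noteq> 0" using W_pos[OF s(1)] by simp
  \<comment> \<open>The angular factors are constant, so all their derivatives vanish and \<mu> = 0;
    \<open>DERIV_over_W5\<close> enters with g = f' f''.\<close>
  have "L_operator 1 (rot_hypersurface f) (rot_Gauss_map f) (separable (\<lambda>s. - (1 / W s)) (\<lambda>t. 1) (\<lambda>w. 1)) p
    = - (2 * \<kappa> (p$1) 2 * (((f2 (p$1) * f2 (p$1) + f3 (p$1) * f1 (p$1)) / W (p$1) ^ 5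
          + 5 * f1 (p$1) * f2 (p$1) * (f1 (p$1) * f2 (p$1)) / W (p$1) ^ 7)
        + f1 (p$1) * f2 (p$1) * (- (f1 (p$1) * f2 (p$1) / W (p$1) ^ 3)) / ((f1 (p$1))\<^sup>2 - 1)\<^sup>2)
      + (\<kappa> (p$1) 1 + \<kappa> (p$1) 2) * (0 * (- (1 / W (p$1))) / (p$1)\<^sup>2
        + 2 * (- (f1 (p$1) * f2 (p$1) / W (p$1) ^ 3)) / (p$1 * ((f1 (p$1))\<^sup>2 - 1)))) * 1 * 1"
    by (rule L_operator_separable[OF p DERIV_inverse_W D DERIV_const DERIV_const DERIV_const DERIV_const]) simp_all
  then show ?thesis
    unfolding \<kappa>_nth axial_identity[OF s(2) W W_sq[OF s(1)]] R_def by simp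
qed

lemma L_Gauss_map_nth:
  assumes p: "p \<in> rot_domain I"
  shows "L_Gauss_map 1 (rot_hypersurface f) (rot_Gauss_map f) p =
    vector [- Q (p$1) / (p$1 ^ 3 * W (p$1) ^ 8) * cosh (p$2) * cosh (p$3),
      - Q (p$1) / (p$1 ^ 3 * W (p$1) ^ 8) * sinh (p$2),
      - Q (p$1) / (p$1 ^ 3 * W (p$1) ^ 8) * cosh (p$2) * sinh (p$3),
      2 * f1 (p$1) * R (p$1) / ((p$1)\<^sup>2 * W (p$1) ^ 8)]"
proof -
  \<comment> \<open>The eigenvalue 2 of the first and third component: 1 + tanh^2 t + 1 / cosh^2 t =
    2.\<close>
  have c: "x + sinh t * sinh t * x / (cosh t * cosh t) + x / (cosh t * cosh t) = 2 * x" for x t :: real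
  proof -
    have "sinh t * sinh t * x + x = cosh t * cosh t * x"
      using cosh_square_eq[of t] by (simp add: power2_eq_square algebra_simps)
    then show ?thesis by (simp add: add.assoc flip: add_divide_distrib)
  qed
  have "cosh t * x + sinh t * x * sinh t / cosh t + cosh t * x / (cosh t)\<^sup>2 = 2 * cosh t * x" for x t :: real
    using c[of "cosh t * x" t] by (simp add: power2_eq_square mult_ac)
  then have
    "L_operator 1 (rot_hypersurface f) (rot_Gauss_map f) (\<lambda>q. rot_Gauss_map f q $ 1) p
      = - Q (p$1) / (p$1 ^ 3 * W (p$1) ^ 8) * cosh (p$2) * cosh (p$3)"
    "L_operator 1 (rot_hypersurface f) (rot_Gauss_map f) (\<lambda>q. rot_Gauss_map f q $ 3) p
      = - Q (p$1) / (p$1 ^ 3 * W (p$1) ^ 8) * cosh (p$2) * sinh (p$3)"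
    unfolding rot_Gauss_map_nth
    by (intro L_operator_spatial[OF p DERIV_cosh_sinh(1,2) DERIV_cosh_sinh(1,2)]
        L_operator_spatial[OF p DERIV_cosh_sinh(1,2) DERIV_cosh_sinh(2,1)]; simp)+
  \<comment> \<open>Here the w-derivative vanishes, and sinh'' and tanh t sinh' each contribute one
    sinh t.\<close>
  moreover have "L_operator 1 (rot_hypersurface f) (rot_Gauss_map f) (\<lambda>q. rot_Gauss_map f q $ 2) p
      = - Q (p$1) / (p$1 ^ 3 * W (p$1) ^ 8) * sinh (p$2) * 1"
    unfolding rot_Gauss_map_nth
    by (rule L_operator_spatial[OF p DERIV_cosh_sinh(2,1) DERIV_const DERIV_const]) simp
  moreover have "L_operator 1 (rot_hypersurface f) (rot_Gauss_map f) (\<lambda>q. rot_Gauss_map f q $ 4) p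
      = 2 * f1 (p$1) * R (p$1) / ((p$1)\<^sup>2 * W (p$1) ^ 8)"
    unfolding rot_Gauss_map_nth by (rule L_operator_axial[OF p])
  ultimately show ?thesis
    by (simp add: vec_eq_iff forall_4 L_Gauss_map_def)
qed

end

section \<open>The multiplier m and the differential equation\<close>

theorem theorem4:
  fixes I :: "real set" and f f1 f2 f3 :: "real \<Rightarrow> real" and C4 :: real
  defines "f1 \<equiv> deriv f" and "f2 \<equiv> deriv f1" and "f3 \<equiv> deriv f2"
  assumes "open I" and "is_interval I" and "0 \<notin> I"
    and "smooth_on f I"
    and "\<forall>s\<in>I. (f1 s)\<^sup>2 < 1" and "\<forall>s\<in>I. f1 s \<noteq> 0"
    and "C4 \<noteq> 0"
    and "\<exists>p\<in>rot_domain I. L_Gauss_map 1 (rot_hypersurface f) (rot_Gauss_map f) p \<noteq> 0"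
    and ode: "\<forall>s\<in>I. 0 =
      (C4 * sqrt (1 - (f1 s)\<^sup>2) - 1) *
        (2 * ((f1 s)\<^sup>2 - 1)^3 * (f1 s)\<^sup>2
         - 2 * s * ((f1 s)\<^sup>2 - 1) * (f1 s)^3 * f2 s
         + 2 * s\<^sup>2 * (4 * (f1 s)\<^sup>2 + 1) * (f2 s)\<^sup>2
         - 2 * s\<^sup>2 * ((f1 s)\<^sup>2 - 1) * f1 s * f3 s)
      - 2 * s *
        (s * ((f1 s)\<^sup>2 - 1) * f1 s * f3 s
         + (((f1 s)\<^sup>2 - 1) * f1 s - s * (3 * (f1 s)\<^sup>2 + 2) * f2 s) * f2 s) * (f1 s)\<^sup>2"
  shows "second_kind_pointwise_1_type 1 (rot_domain I) (rot_hypersurface f) (rot_Gauss_map f) \<and>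
    (\<exists>m. smooth_on m (rot_domain I) \<and> (\<exists>p\<in>rot_domain I. m p \<noteq> 0) \<and>
       (\<forall>p\<in>rot_domain I. L_Gauss_map 1 (rot_hypersurface f) (rot_Gauss_map f) p
          = m p *\<^sub>R (rot_Gauss_map f p + vector [0, 0, 0, C4])))"
proof -
  interpret rotational_profile I f
    using assms by unfold_locales auto
  define m where "m s = Q s / (f1 s * (s ^ 3 * W s ^ 7))" for s
  let ?C = "vector [0, 0, 0, C4] :: real^4"
  have ode': "(C4 * W s - 1) * Q s = 2 * s * R s * (f1 s)\<^sup>2" if "s \<in> I" for s
    using ode[rule_format, OF that] unfolding Q_def R_def W_def f1_def f2_def f3_def by simp
  have L: "L_Gauss_map 1 (rot_hypersurface f) (rot_Gauss_map f) p = m (p$1) *\<^sub>R (rot_Gauss_map f p + ?C)"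
    if p: "p \<in> rot_domain I" for p
  proof -
    have s: "p$1 \<in> I" "p$1 \<noteq> 0" using p \<open>0 \<notin> I\<close> by (auto simp: rot_domain_def)
    have nz: "W (p$1) \<noteq> 0" "f1 (p$1) \<noteq> 0" using W_pos[OF s(1)] assms(9) s(1) by auto
    have "- Q (p$1) / (p$1 ^ 3 * W (p$1) ^ 8) = m (p$1) * (- (f1 (p$1) / W (p$1)))"
      using nz s(2) by (simp add: m_def field_simps eval_nat_numeral)
    moreover have "2 * f1 (p$1) * R (p$1) / ((p$1)\<^sup>2 * W (p$1) ^ 8) = m (p$1) * (- (1 / W (p$1)) + C4)"
    proof -
      \<comment> \<open>Over the common denominator the equation \<open>ode'\<close> can replace the
        numerator; one factor s and one factor f' then cancel.\<close>
      have "m (p$1) * (- (1 / W (p$1)) + C4)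
          = (C4 * W (p$1) - 1) * Q (p$1) / (f1 (p$1) * (p$1 ^ 3 * W (p$1) ^ 8))"
        using nz s(2) by (simp add: m_def field_simps eval_nat_numeral)
      also have "\<dots> = 2 * f1 (p$1) * R (p$1) / ((p$1)\<^sup>2 * W (p$1) ^ 8)"
        unfolding ode'[OF s(1)] using nz s(2) by (simp add: field_simps eval_nat_numeral)
      finally show ?thesis ..
    qed
    ultimately show ?thesis
      unfolding L_Gauss_map_nth[OF p]
      by (simp add: vec_eq_iff forall_4 fun_cong[OF rot_Gauss_map_nth(1)] fun_cong[OF rot_Gauss_map_nth(2)]
          fun_cong[OF rot_Gauss_map_nth(3)] fun_cong[OF rot_Gauss_map_nth(4)] separable_def f1_def)
  qed
  have "smooth_on Q I"
    unfolding Q_def[abs_def]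
    by (intro smooth_on_add smooth_on_diff smooth_on_mult smooth_on_power smooth_on_const smooth_derivs
        open_I smooth_on_bounded_linear[OF open_I bounded_linear_ident])
  then have "smooth_on m I"
    unfolding m_def[abs_def] f1_def
    by (intro smooth_on_divide smooth_on_mult smooth_on_power smooth_W smooth_derivs
        open_I smooth_on_bounded_linear[OF open_I bounded_linear_ident])
      (use W_pos assms(9) \<open>0 \<notin> I\<close> in \<open>auto simp: f1_def less_le\<close>)
  then have "smooth_on (\<lambda>p. m (p$1)) (rot_domain I)"
    by (rule smooth_on_profile[OF open_rot_domain open_I]) (auto simp: rot_domain_def)
  \<comment> \<open>At a point where L_1 N does not vanish, \<open>L\<close> excludes m = 0.\<close>
  moreover have "\<exists>p\<in>rot_domain I. m (p$1) \<noteq> 0"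
    using assms(11) L by force
  moreover have "?C \<noteq> 0"
    using \<open>C4 \<noteq> 0\<close> by (metis vector_4(4) zero_index)
  ultimately show ?thesis
    unfolding second_kind_pointwise_1_type_def
    using oriented_rot_hypersurface L by blast
qed

end
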